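(* Let $X$ be a Banach space. Then there exists an equivalent norm on $X$ such that $X$ is an almost square (ASQ) Banach space under the new norm if, and only if, $X$ contains an isomorphic copy of $c_0$.
   Context: All Banach spaces are real. $S_X$ denotes the unit sphere of a Banach space $X$. A Banach space $X$ is almost square (ASQ) if for every finite collection $x_1,\ldots,x_k$ of elements of $S_X$ there exists a sequence $\{y_m\}$ in $S_X$ such that $\|y_m\|\to 1$ and $\|x_i\pm y_m\|\to 1$ as $m\to\infty$ (for both choices of sign) for every $i\in\{1,\ldots,k\}$. Here $c_0$ is the Banach space of real sequences converging to $0$ with the supremum norm, and $X$ contains an isomorphic copy of $c_0$ if it has a closed subspace linearly homeomorphic to $c_0$. *)

theory Defs
  imports "HOL-Analysis.Analysis"
begin

text \<open>A second norm on the vector space underlying \<open>X\<close> is a function \<open>N\<close> on the type of \<open>X\<close>.\<close>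

definition is_norm :: "('a::real_vector \<Rightarrow> real) \<Rightarrow> bool" where
  "is_norm N \<longleftrightarrow>
     (\<forall>x. 0 \<le> N x) \<and>
     (\<forall>x. N x = 0 \<longleftrightarrow> x = 0) \<and>
     (\<forall>x y. N (x + y) \<le> N x + N y) \<and>
     (\<forall>r x. N (r *\<^sub>R x) = \<bar>r\<bar> * N x)"

definition banach_norm :: "('a::real_vector \<Rightarrow> real) \<Rightarrow> bool" where
  "banach_norm N \<longleftrightarrow> is_norm N \<and> Metric_space.mcomplete UNIV (\<lambda>x y. N (x - y))"

definition equivalent_norm :: "('a::real_normed_vector \<Rightarrow> real) \<Rightarrow> bool" where
  "equivalent_norm N \<longleftrightarrow>
     is_norm N \<and> (\<exists>c C. 0 < c \<and> 0 < C \<and> (\<forall>x. c * norm x \<le> N x \<and> N x \<le> C * norm x))"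

definition unit_sphere :: "('a::real_vector \<Rightarrow> real) \<Rightarrow> 'a set" where
  "unit_sphere N = {x. N x = 1}"

text \<open>The finite collection \<open>F\<close> may be empty. For a nonzero space this case is harmless; for
  the zero space, whose unit sphere is empty, it is what makes the space fail to be almost square.\<close>

definition almost_square :: "('a::real_vector \<Rightarrow> real) \<Rightarrow> bool" where
  "almost_square N \<longleftrightarrow>
     (\<forall>F. finite F \<and> F \<subseteq> unit_sphere N \<longrightarrow>
        (\<exists>y::nat \<Rightarrow> 'a. range y \<subseteq> unit_sphere N \<and>
           (\<lambda>m. N (y m)) \<longlonglongrightarrow> 1 \<and>
           (\<forall>x\<in>F. (\<lambda>m. N (x + y m)) \<longlonglongrightarrow> 1 \<and> (\<lambda>m. N (x - y m)) \<longlonglongrightarrow> 1)))"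

text \<open>As \<open>nat\<close> is discrete, \<open>nat \<Rightarrow>\<^sub>C real\<close> is the space of all bounded real sequences with the
  supremum norm.\<close>

definition c0 :: "(nat \<Rightarrow>\<^sub>C real) set" where
  "c0 = {f. apply_bcontfun f \<longlonglongrightarrow> 0}"

text \<open>The maps below are total functions; only their restrictions to \<open>c0\<close> and \<open>Y\<close> matter.\<close>

definition linearly_homeomorphic_to_c0 :: "'a::real_normed_vector set \<Rightarrow> bool" where
  "linearly_homeomorphic_to_c0 Y \<longleftrightarrow>
     (\<exists>T S. homeomorphism c0 Y T S \<and>
        (\<forall>f\<in>c0. \<forall>g\<in>c0. T (f + g) = T f + T g) \<and>
        (\<forall>r. \<forall>f\<in>c0. T (r *\<^sub>R f) = r *\<^sub>R T f))"

definition contains_copy_of_c0 :: "'a::real_normed_vector itself \<Rightarrow> bool" where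
  "contains_copy_of_c0 _ \<longleftrightarrow>
     (\<exists>Y::'a set. subspace Y \<and> closed Y \<and> linearly_homeomorphic_to_c0 Y)"

end

theory Submission
  imports Defs
begin

text \<open>
  If a norm \<open>N\<close> is almost square, one chooses unit vectors \<open>y 0, y 1, \<dots>\<close> one after the other such that
  all sums \<open>\<plusminus> y 0 \<plusminus> \<dots> \<plusminus> y n\<close> have norm at most \<open>3/2\<close>: almost squareness, applied to the
  finitely many sums already formed, provides the next vector. By convexity the bound \<open>3/2\<close> extends to
  all coefficients in \<open>[- 1, 1]\<close>, and because \<open>3/2 < 2\<close> it implies a lower bound, so that \<open>(y n)\<close> is
  equivalent to the unit vector sequence of \<open>c0\<close> (\<open>almost_square_c0_basis\<close>). The map sending
  a null sequence \<open>a\<close> to \<open>\<Sum>n. a n y n\<close> then embeds \<open>c0\<close> as a closed subspace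
  (\<open>contains_copy_of_c0_if_c0_basis\<close>).

  Conversely, let \<open>Y\<close> be a copy of \<open>c0\<close>. The coordinate functionals on \<open>Y\<close> extend to functionals \<open>f n\<close>
  on the whole space with a common bound (\<open>Hahn_Banach_norm_extension\<close>). Let \<open>L\<close> be a weak-star cluster
  point of \<open>(f n)\<close> (\<open>weak_star_cluster_point\<close>). As null sequences tend to \<open>0\<close>, \<open>L\<close> vanishes on \<open>Y\<close>, and
  the functionals \<open>g n = f n - L\<close> still are the coordinates on \<open>Y\<close>. What is gained is that the values
  \<open>g n x\<close> have \<open>0\<close> as a cluster point, jointly for any finite set of vectors \<open>x\<close>. The norm
  \<open>N x = max (sup\<^sub>n \<bar>g n x\<bar>) (dist x Y)\<close> is equivalent to the given one, and it is almost square: for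
  finitely many unit vectors \<open>x\<close>, choose \<open>n\<close> with all \<open>g n x\<close> small; then adding or subtracting the
  \<open>n\<close>-th unit vector of \<open>Y\<close> changes only the \<open>n\<close>-th coordinate, and makes it almost \<open>\<plusminus> 1\<close>
  (\<open>almost_square_renorming\<close>).
\<close>

section \<open>The Hahn--Banach theorem\<close>

definition sublinear :: "('a::real_vector \<Rightarrow> real) \<Rightarrow> bool" where
  "sublinear q \<longleftrightarrow> (\<forall>x y. q (x + y) \<le> q x + q y) \<and> (\<forall>t x. 0 \<le> t \<longrightarrow> q (t *\<^sub>R x) = t * q x)"

text \<open>The functional \<open>r x\<close> is the infimum of \<open>q (x + k) - h k\<close> over \<open>k \<in> K\<close>, which is
finite because \<open>h \<le> q\<close> on \<open>K\<close> makes every term at least \<open>- q (- x)\<close>. With \<open>K\<close> a ray and \<open>h = q\<close> it shows that a minimal sublinear functional is odd; with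
\<open>K\<close> a subspace and \<open>h\<close> linear it forces every linear functional below \<open>r\<close> to extend \<open>h\<close>.\<close>
lemma sublinear_minus_on_cone:
  fixes q :: "'a::real_vector \<Rightarrow> real"
  assumes q: "sublinear q"
    and K0: "0 \<in> K" and Kadd: "\<And>k l. k \<in> K \<Longrightarrow> l \<in> K \<Longrightarrow> k + l \<in> K"
    and Kscale: "\<And>t k. 0 \<le> t \<Longrightarrow> k \<in> K \<Longrightarrow> t *\<^sub>R k \<in> K"
    and hadd: "\<And>k l. k \<in> K \<Longrightarrow> l \<in> K \<Longrightarrow> h (k + l) = h k + h l"
    and hscale: "\<And>t k. 0 \<le> t \<Longrightarrow> k \<in> K \<Longrightarrow> h (t *\<^sub>R k) = t * h k"
    and hq: "\<And>k. k \<in> K \<Longrightarrow> h k \<le> q k"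
  obtains r where "sublinear r" "\<And>x. r x \<le> q x" "\<And>k. k \<in> K \<Longrightarrow> r (- k) \<le> - h k"
proof -
  have qadd: "q (x + y) \<le> q x + q y" and qscale: "0 \<le> t \<Longrightarrow> q (t *\<^sub>R x) = t * q x" for x y t
    using q by (auto simp: sublinear_def)
  have q0: "q 0 = 0" using qscale[of 0 0] by simp
  have h0: "h 0 = 0" using hscale[of 0 0] K0 by simp
  define r where "r x = (INF k\<in>K. q (x + k) - h k)" for x
  have low: "- q (- x) \<le> q (x + k) - h k" if "k \<in> K" for x k
    using qadd[of "x + k" "- x"] hq[OF that] by simp
  have bdd: "bdd_below ((\<lambda>k. q (x + k) - h k) ` K)" for x
    using low by (intro bdd_belowI2)
  have r_le: "r x \<le> q (x + k) - h k" if "k \<in> K" for x k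
    unfolding r_def by (rule cINF_lower[OF bdd that])
  have r_ge: "c \<le> r x" if "\<And>k. k \<in> K \<Longrightarrow> c \<le> q (x + k) - h k" for x c
    unfolding r_def using K0 that by (intro cINF_greatest) auto
  have r_add: "r (x + y) \<le> r x + r y" for x y
  proof -
    have "r (x + y) - (q (x + k) - h k) \<le> r y" if k: "k \<in> K" for k
    proof (rule r_ge)
      fix l assume l: "l \<in> K"
      show "r (x + y) - (q (x + k) - h k) \<le> q (y + l) - h l"
        using r_le[OF Kadd[OF k l], of "x + y"] qadd[of "x + k" "y + l"] hadd[OF k l]
        by (simp add: algebra_simps)
    qed
    then have "r (x + y) - r y \<le> r x"
      by (intro r_ge) (simp add: algebra_simps)
    then show ?thesis by simp
  qed
  have r_scale_le: "t * r x \<le> r (t *\<^sub>R x)" if t: "0 < t" for t x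
  proof (rule r_ge)
    fix k assume k: "k \<in> K"
    have l: "inverse t *\<^sub>R k \<in> K" using Kscale[of "inverse t" k] t k by simp
    have "t * r x \<le> t * (q (x + inverse t *\<^sub>R k) - h (inverse t *\<^sub>R k))"
      using r_le[OF l, of x] t by simp
    also have "\<dots> = q (t *\<^sub>R (x + inverse t *\<^sub>R k)) - h (t *\<^sub>R inverse t *\<^sub>R k)"
      using qscale[of t "x + inverse t *\<^sub>R k"] hscale[OF _ l, of t] t by (simp only: right_diff_distrib)
    also have "\<dots> = q (t *\<^sub>R x + k) - h k"
      using t by (simp add: scaleR_add_right)
    finally show "t * r x \<le> q (t *\<^sub>R x + k) - h k" .
  qed
  have "r 0 \<le> 0" using r_le[OF K0, of 0] q0 h0 by simp
  moreover have "0 \<le> r 0" using low[of _ 0] q0 by (intro r_ge) simp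
  ultimately have r0: "r 0 = 0" by simp
  have r_scale: "r (t *\<^sub>R x) = t * r x" if t: "0 \<le> t" for t x
  proof (cases "t = 0")
    case False
    then have t: "0 < t" using t by simp
    have "inverse t * r (t *\<^sub>R x) \<le> r x"
      using r_scale_le[of "inverse t" "t *\<^sub>R x"] t by simp
    then have "r (t *\<^sub>R x) \<le> t * r x"
      using t by (simp add: field_simps)
    then show ?thesis using r_scale_le[OF t, of x] by simp
  qed (simp add: r0)
  show thesis
  proof (rule that)
    show "sublinear r" unfolding sublinear_def using r_add r_scale by blast
    show "r x \<le> q x" for x using r_le[OF K0, of x] h0 by simp
    show "r (- k) \<le> - h k" if "k \<in> K" for k using r_le[OF that, of "- k"] q0 by simp
  qed
qed

text \<open>Zorn's lemma applies because the pointwise infimum of a chain of sublinear functionals is sublinear.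
The infimum cannot be \<open>-\<infinity>\<close>: a sublinear \<open>q \<le> p\<close> satisfies \<open>q x \<ge> - q (- x) \<ge> - p (- x)\<close>.\<close>
lemma minimal_sublinear_exists:
  fixes p :: "'a::real_vector \<Rightarrow> real"
  assumes p: "sublinear p"
  obtains q where "sublinear q" "q \<le> p" "\<And>r. sublinear r \<Longrightarrow> r \<le> q \<Longrightarrow> r = q"
proof -
  define A where "A = {q. sublinear q \<and> q \<le> p}"
  define P where "P = (\<lambda>q r :: 'a \<Rightarrow> real. r \<le> q)"
  have "\<exists>m \<in> A. \<forall>a \<in> A. P m a \<longrightarrow> a = m"
  proof (rule predicate_Zorn)
    show "partial_order_on A (relation_of P A)"
      by (rule partial_order_on_relation_ofI) (auto simp: P_def)
    fix C assume C: "C \<in> Chains (relation_of P A)"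
    show "\<exists>u\<in>A. \<forall>a\<in>C. P a u"
    proof (cases "C = {}")
      case True
      then show ?thesis using p by (auto simp: A_def)
    next
      case False
      have CA: "q \<in> A" if "q \<in> C" for q
        using C that by (auto simp: Chains_def relation_of_def)
      have chain: "q \<le> r \<or> r \<le> q" if "q \<in> C" "r \<in> C" for q r
        using C that by (auto simp: Chains_def relation_of_def P_def)
      have qadd: "q (x + y) \<le> q x + q y" and qscale: "0 \<le> t \<Longrightarrow> q (t *\<^sub>R x) = t * q x"
        and qp: "q x \<le> p x"
        if "q \<in> C" for q x y t
        using CA[OF that] by (auto simp: A_def sublinear_def le_fun_def)
      define u where "u x = (INF q\<in>C. q x)" for x
      have low: "- p (- x) \<le> q x" if "q \<in> C" for q x
        using qadd[OF that, of x "- x"] qp[OF that, of "- x"] qscale[OF that, of 0 0] by simp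
      have bdd: "bdd_below ((\<lambda>q. q x) ` C)" for x
        using low by (intro bdd_belowI2)
      have u_le: "u x \<le> q x" if "q \<in> C" for x q
        unfolding u_def by (rule cINF_lower[OF bdd that])
      have u_ge: "c \<le> u x" if "\<And>q. q \<in> C \<Longrightarrow> c \<le> q x" for x c
        unfolding u_def using False that by (intro cINF_greatest) auto
      have u_add: "u (x + y) \<le> u x + u y" for x y
      proof -
        have "u (x + y) - q x \<le> u y" if q: "q \<in> C" for q
        proof (rule u_ge)
          fix r assume r: "r \<in> C"
          \<comment> \<open>Subadditivity of the smaller of the two members of the chain gives the mixed bound.\<close>
          have "u (x + y) \<le> q x + r y"
            using chain[OF q r]
          proof
            assume "q \<le> r"
            then show ?thesis using u_le[OF q, of "x + y"] qadd[OF q, of x y]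
              by (smt (verit) le_fun_def)
          next
            assume "r \<le> q"
            then show ?thesis using u_le[OF r, of "x + y"] qadd[OF r, of x y]
              by (smt (verit) le_fun_def)
          qed
          then show "u (x + y) - q x \<le> r y" by simp
        qed
        then have "u (x + y) - u y \<le> u x" by (intro u_ge) (simp add: algebra_simps)
        then show ?thesis by simp
      qed
      have u_scale_le: "t * u x \<le> u (t *\<^sub>R x)" if "0 \<le> t" for t x
        using u_le that by (intro u_ge) (simp add: qscale mult_left_mono)
      have u_scale: "u (t *\<^sub>R x) = t * u x" if t: "0 \<le> t" for t x
      proof (cases "t = 0")
        case True
        obtain q where "q \<in> C" using False by blast
        then show ?thesis using u_le[of q 0] qscale[of q 0 0] u_scale_le[of 0 x] True by simp
      next
        case False
        then have t: "0 < t" using t by simp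
        have "inverse t * u (t *\<^sub>R x) \<le> u x"
          using u_scale_le[of "inverse t" "t *\<^sub>R x"] t by simp
        then have "u (t *\<^sub>R x) \<le> t * u x"
          using t by (simp add: field_simps)
        then show ?thesis using u_scale_le[of t x] t by simp
      qed
      have "u \<le> p"
        using False u_le qp by (metis ex_in_conv le_funI order_trans)
      then have "u \<in> A" using u_add u_scale by (auto simp: A_def sublinear_def)
      then show ?thesis using u_le by (auto simp: P_def le_fun_def)
    qed
  qed
  then obtain q where "q \<in> A" "\<And>r. r \<in> A \<Longrightarrow> P q r \<Longrightarrow> r = q" by blast
  then show thesis
    using that[of q] by (auto simp: A_def P_def)
qed

text \<open>A minimal sublinear functional \<open>q\<close> is linear. Lowering \<open>q\<close> along the ray through \<open>y\<close> gives a
sublinear functional below \<open>q\<close>, hence \<open>q\<close> itself, so that \<open>q (- y) \<le> - q y\<close>; a sublinear functional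
that is odd is additive and homogeneous.\<close>
lemma linear_below_sublinear:
  fixes p :: "'a::real_vector \<Rightarrow> real"
  assumes "sublinear p"
  obtains l where "linear l" "\<And>x. l x \<le> p x"
proof -
  obtain q where q: "sublinear q" "q \<le> p" and min: "\<And>r. sublinear r \<Longrightarrow> r \<le> q \<Longrightarrow> r = q"
    using minimal_sublinear_exists[OF assms] by blast
  have qadd: "q (x + y) \<le> q x + q y" and qscale: "0 \<le> t \<Longrightarrow> q (t *\<^sub>R x) = t * q x" for x y t
    using q by (auto simp: sublinear_def)
  have odd: "q (- y) = - q y" for y
  proof -
    define K where "K = (\<lambda>t. t *\<^sub>R y) ` {0..}"
    obtain r where r: "sublinear r" "\<And>x. r x \<le> q x" "\<And>k. k \<in> K \<Longrightarrow> r (- k) \<le> - q k"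
    proof (rule sublinear_minus_on_cone[OF q(1), of K q])
      show "0 \<in> K" unfolding K_def by (rule image_eqI[of _ _ 0]) auto
      fix k l assume "k \<in> K" "l \<in> K"
      then obtain s t where kl: "k = s *\<^sub>R y" "l = t *\<^sub>R y" "0 \<le> s" "0 \<le> t" by (auto simp: K_def)
      then have sum: "k + l = (s + t) *\<^sub>R y" by (simp add: scaleR_add_left)
      show "k + l \<in> K" unfolding K_def sum using kl by auto
      show "q (k + l) = q k + q l" unfolding sum using kl by (simp add: qscale distrib_right)
    next
      fix t :: real and k assume "0 \<le> t" "k \<in> K"
      then obtain s where "k = s *\<^sub>R y" "0 \<le> s" by (auto simp: K_def)
      then show "t *\<^sub>R k \<in> K" unfolding K_def using \<open>0 \<le> t\<close> by auto
    qed (use qscale in auto)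
    have "r = q" using r by (intro min) (auto simp: le_fun_def)
    moreover have "y \<in> K" unfolding K_def by (rule image_eqI[of _ _ 1]) auto
    ultimately have "q (- y) \<le> - q y" using r(3) by auto
    then show ?thesis using qadd[of y "- y"] qscale[of 0 0] by simp
  qed
  have "linear q"
  proof
    fix x y
    show "q (x + y) = q x + q y"
      using qadd[of x y] qadd[of "- x" "- y"] odd[of x] odd[of y] odd[of "x + y"] by simp
  next
    fix t x
    show "q (t *\<^sub>R x) = t *\<^sub>R q x"
      using qscale[of t x] qscale[of "- t" x] odd[of "t *\<^sub>R x"] by (cases "0 \<le> t") auto
  qed
  then show thesis using that q(2) by (auto simp: le_fun_def)
qed

theorem Hahn_Banach_norm_extension:
  fixes f :: "'a::real_normed_vector \<Rightarrow> real"
  assumes Y: "subspace Y"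
    and add: "\<And>x y. x \<in> Y \<Longrightarrow> y \<in> Y \<Longrightarrow> f (x + y) = f x + f y"
    and scale: "\<And>t x. x \<in> Y \<Longrightarrow> f (t *\<^sub>R x) = t * f x"
    and bound: "\<And>x. x \<in> Y \<Longrightarrow> \<bar>f x\<bar> \<le> C * norm x" and "0 \<le> C"
  obtains l where "linear l" "\<And>x. \<bar>l x\<bar> \<le> C * norm x" "\<And>x. x \<in> Y \<Longrightarrow> l x = f x"
proof -
  have "sublinear (\<lambda>x::'a. C * norm x)"
    using norm_triangle_ineq \<open>0 \<le> C\<close> by (auto simp: sublinear_def simp flip: distrib_left intro!: mult_left_mono)
  then obtain p where p: "sublinear p" "\<And>x. p x \<le> C * norm x" "\<And>y. y \<in> Y \<Longrightarrow> p (- y) \<le> - f y"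
  proof (rule sublinear_minus_on_cone[of _ Y f])
    show "f k \<le> C * norm k" if "k \<in> Y" for k using bound[OF that] by simp
  qed (use add scale Y in \<open>auto simp: subspace_def\<close>)
  obtain l where l: "linear l" "\<And>x. l x \<le> p x" using linear_below_sublinear[OF p(1)] by blast
  have neg: "l (- x) = - l x" for x using linear_neg[OF l(1)] .
  show thesis
  proof
    show "linear l" by fact
    show "\<bar>l x\<bar> \<le> C * norm x" for x
      using order_trans[OF l(2) p(2), of x] order_trans[OF l(2) p(2), of "- x"] neg[of x] by simp
    show "l y = f y" if "y \<in> Y" for y
    proof -
      have y: "- y \<in> Y" using subspace_neg[OF Y that] .
      have "f (- y) = - f y" using scale[OF that, of "-1"] by simp
      then show ?thesis
        using order_trans[OF l(2) p(3)[OF that]] order_trans[OF l(2) p(3)[OF y]] neg[of y] by simp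
    qed
  qed
qed

section \<open>Cluster points of bounded sequences of functionals\<close>

text \<open>This is the Banach--Alaoglu argument: the functionals lie in the product of the intervals
\<open>[- C \<bar>x\<bar>, C \<bar>x\<bar>]\<close>, which is compact by Tychonoff's theorem, so the sequence has a cluster point
for pointwise convergence. In general no subsequence converges pointwise; it is enough that every
finite set of vectors sees infinitely many members of the sequence close to the cluster point.\<close>
lemma weak_star_cluster_point:
  fixes f :: "nat \<Rightarrow> 'a::real_normed_vector \<Rightarrow> real"
  assumes lin: "\<And>n. linear (f n)" and bound: "\<And>n x. \<bar>f n x\<bar> \<le> C * norm x"
  shows "\<exists>L. linear L \<and> (\<forall>x. \<bar>L x\<bar> \<le> C * norm x) \<and>
    (\<forall>F \<epsilon>. finite F \<longrightarrow> 0 < \<epsilon> \<longrightarrow> (\<exists>\<^sub>F n in sequentially. \<forall>x\<in>F. \<bar>f n x - L x\<bar> < \<epsilon>))"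
proof -
  define K where "K = PiE (UNIV::'a set) (\<lambda>x. {- (C * norm x)..C * norm x})"
  have "compactin (product_topology (\<lambda>_::'a. euclideanreal) UNIV) K"
    unfolding K_def by (simp add: compactin_PiE)
  then have "compact K" by (simp add: euclidean_product_topology)
  moreover have "filtermap f sequentially \<noteq> bot" by (simp add: filtermap_bot_iff)
  moreover have "f n \<in> K" for n
    using bound[of n] by (auto simp: K_def abs_le_iff) (metis add.commute minus_le_iff)
  then have "eventually (\<lambda>h. h \<in> K) (filtermap f sequentially)"
    by (simp add: eventually_filtermap)
  ultimately obtain L where L: "L \<in> K" "inf (nhds L) (filtermap f sequentially) \<noteq> bot"
    unfolding compact_filter by blast
  have cluster: "\<exists>\<^sub>F n in sequentially. \<forall>x\<in>F. \<bar>f n x - L x\<bar> < \<epsilon>"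
    if F: "finite F" and \<epsilon>: "0 < \<epsilon>" for F \<epsilon>
  proof -
    define U where "U = {h. \<forall>x\<in>F. h x \<in> ball (L x) \<epsilon>}"
    have "open U" unfolding U_def
      using product_topology_basis'[OF F, of "\<lambda>x. ball (L x) \<epsilon>" "\<lambda>x. x"] by simp
    moreover have "L \<in> U" using \<epsilon> by (simp add: U_def)
    ultimately have "eventually (\<lambda>h. h \<in> U) (nhds L)" by (rule eventually_nhds_in_open)
    then have "\<not> eventually (\<lambda>h. h \<notin> U) (filtermap f sequentially)"
      using L(2) eventually_inf[of "\<lambda>_. False" "nhds L" "filtermap f sequentially"]
      unfolding trivial_limit_def by blast
    then have "\<exists>\<^sub>F n in sequentially. f n \<in> U"
      by (simp add: frequently_def eventually_filtermap)
    then show ?thesis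
      by (simp add: U_def dist_real_def abs_minus_commute)
  qed
  have near: "\<exists>n. \<forall>x\<in>F. \<bar>f n x - L x\<bar> < \<epsilon>" if "finite F" "0 < \<epsilon>" for F \<epsilon>
    using frequently_ex[OF cluster[OF that]] .
  have "linear L"
  proof
    fix x y
    show "L (x + y) = L x + L y"
    proof (rule ccontr)
      assume ne: "L (x + y) \<noteq> L x + L y"
      define \<epsilon> where "\<epsilon> = \<bar>L (x + y) - L x - L y\<bar> / 3"
      have "0 < \<epsilon>" using ne by (simp add: \<epsilon>_def)
      then obtain n where "\<forall>z\<in>{x, y, x + y}. \<bar>f n z - L z\<bar> < \<epsilon>"
        using near[of "{x, y, x + y}" \<epsilon>] by auto
      moreover have "f n (x + y) = f n x + f n y" using linear_add[OF lin] .
      ultimately have "\<bar>L (x + y) - L x - L y\<bar> < 3 * \<epsilon>" by auto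
      then show False by (simp add: \<epsilon>_def)
    qed
  next
    fix t x
    show "L (t *\<^sub>R x) = t *\<^sub>R L x"
    proof (rule ccontr)
      assume ne: "L (t *\<^sub>R x) \<noteq> t *\<^sub>R L x"
      define \<epsilon> where "\<epsilon> = \<bar>L (t *\<^sub>R x) - t * L x\<bar> / (1 + \<bar>t\<bar>)"
      have "0 < \<epsilon>" using ne by (simp add: \<epsilon>_def)
      then obtain n where n: "\<forall>z\<in>{x, t *\<^sub>R x}. \<bar>f n z - L z\<bar> < \<epsilon>"
        using near[of "{x, t *\<^sub>R x}" \<epsilon>] by auto
      have "\<bar>L (t *\<^sub>R x) - t * L x\<bar> = \<bar>t * (f n x - L x) - (f n (t *\<^sub>R x) - L (t *\<^sub>R x))\<bar>"
        using linear_scale[OF lin, of n t x] by (simp add: algebra_simps)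
      also have "\<dots> \<le> \<bar>t\<bar> * \<bar>f n x - L x\<bar> + \<bar>f n (t *\<^sub>R x) - L (t *\<^sub>R x)\<bar>"
        using abs_triangle_ineq4 by (metis abs_mult)
      also have "\<dots> < \<bar>t\<bar> * \<epsilon> + \<epsilon>"
        using n by (intro add_le_less_mono mult_left_mono) auto
      also have "\<dots> = \<epsilon> * (1 + \<bar>t\<bar>)"
        by (simp add: algebra_simps)
      also have "\<dots> = \<bar>L (t *\<^sub>R x) - t * L x\<bar>"
        unfolding \<epsilon>_def by simp
      finally show False by simp
    qed
  qed
  moreover have "\<bar>L x\<bar> \<le> C * norm x" for x
    using L(1) by (auto simp: K_def PiE_iff abs_le_iff) (metis minus_le_iff)
  ultimately show ?thesis using cluster by (intro exI[of _ L]) simp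
qed

section \<open>An almost square norm built from functionals\<close>

lemma homogeneous_if_subhomogeneous:
  fixes p :: "'a::real_vector \<Rightarrow> real"
  assumes sub: "\<And>r x. p (r *\<^sub>R x) \<le> \<bar>r\<bar> * p x"
    and nonneg: "\<And>x. 0 \<le> p x"
  shows "p (r *\<^sub>R x) = \<bar>r\<bar> * p x"
proof (cases "r = 0")
  case True
  then show ?thesis using sub[of 0 x] nonneg[of 0] by simp
next
  case False
  have "p x \<le> inverse \<bar>r\<bar> * p (r *\<^sub>R x)"
    using sub[of "inverse r" "r *\<^sub>R x"] False by simp
  then have "\<bar>r\<bar> * p x \<le> p (r *\<^sub>R x)" using False by (simp add: field_simps)
  then show ?thesis using sub[of r x] by simp
qed

lemma infdist_approx:
  assumes "Y \<noteq> {}" "infdist x Y < e"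
  obtains y where "y \<in> Y" "dist x y < e"
  using assms by (metis cINF_greatest infdist_notempty leD not_less)

lemma infdist_subspace_add_le:
  assumes Y: "subspace (Y::'a::real_normed_vector set)"
  shows "infdist (x + y) Y \<le> infdist x Y + infdist y Y"
proof (rule field_le_epsilon)
  fix e :: real assume e: "0 < e"
  have ne: "Y \<noteq> {}" using subspace_0[OF Y] by blast
  obtain u v where u: "u \<in> Y" "dist x u < infdist x Y + e/2" and v: "v \<in> Y" "dist y v < infdist y Y + e/2"
    using infdist_approx[OF ne, of x "infdist x Y + e/2"] infdist_approx[OF ne, of y "infdist y Y + e/2"] e
    by (metis half_gt_zero less_add_same_cancel1)
  have "infdist (x + y) Y \<le> dist (x + y) (u + v)"
    by (rule infdist_le) (use Y u v in \<open>auto intro: subspace_add\<close>)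
  also have "\<dots> \<le> dist x u + dist y v" by (rule dist_triangle_add)
  finally show "infdist (x + y) Y \<le> infdist x Y + infdist y Y + e" using u v by simp
qed

lemma infdist_subspace_scale:
  assumes Y: "subspace (Y::'a::real_normed_vector set)"
  shows "infdist (r *\<^sub>R x) Y = \<bar>r\<bar> * infdist x Y"
proof (rule homogeneous_if_subhomogeneous[of "\<lambda>x. infdist x Y"])
  fix r x
  have ne: "Y \<noteq> {}" using subspace_0[OF Y] by blast
  show "infdist (r *\<^sub>R x) Y \<le> \<bar>r\<bar> * infdist x Y"
  proof (cases "r = 0")
    case True
    then show ?thesis using subspace_0[OF Y] by simp
  next
    case False
    have "infdist (r *\<^sub>R x) Y / \<bar>r\<bar> \<le> infdist x Y"
      unfolding infdist_notempty[OF ne, of x]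
    proof (rule cINF_greatest[OF ne])
      fix y assume "y \<in> Y"
      then have "infdist (r *\<^sub>R x) Y \<le> dist (r *\<^sub>R x) (r *\<^sub>R y)"
        by (intro infdist_le subspace_scale[OF Y])
      also have "\<dots> = \<bar>r\<bar> * dist x y"
        by (simp add: dist_norm flip: scaleR_diff_right)
      finally show "infdist (r *\<^sub>R x) Y / \<bar>r\<bar> \<le> dist x y" using False by (simp add: field_simps)
    qed
    then show ?thesis using False by (simp add: field_simps)
  qed
qed (rule infdist_nonneg)

lemma infdist_subspace_add_member:
  assumes Y: "subspace (Y::'a::real_normed_vector set)" and y: "y \<in> Y"
  shows "infdist (x + y) Y \<le> infdist x Y"
  using infdist_subspace_add_le[OF Y, of x y] y by simp

lemma equivalent_norm_imp_banach_norm: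
  fixes N :: "'a::banach \<Rightarrow> real"
  assumes "equivalent_norm N"
  shows "banach_norm N"
proof -
  obtain c C where N: "is_norm N" and c: "0 < c" "0 < C" "\<And>x. c * norm x \<le> N x" "\<And>x. N x \<le> C * norm x"
    using assms by (auto simp: equivalent_norm_def)
  have N0: "N x = 0 \<longleftrightarrow> x = 0" and Npos: "0 \<le> N x" and Nadd: "N (x + y) \<le> N x + N y"
    and Nscale: "N (r *\<^sub>R x) = \<bar>r\<bar> * N x" for x y r
    using N by (auto simp: is_norm_def)
  have Nminus: "N (x - y) = N (y - x)" for x y using Nscale[of "-1" "x - y"] by simp
  interpret M: Metric_space UNIV "\<lambda>x y. N (x - y)"
  proof
    fix x y z
    show "N (x - z) \<le> N (x - y) + N (y - z)" using Nadd[of "x - y" "y - z"] by simp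
  qed (use N0 Npos Nminus in auto)
  have "M.mcomplete"
    unfolding M.mcomplete_def
  proof (intro allI impI)
    fix s assume s: "M.MCauchy s"
    have "Cauchy s"
    proof (rule metric_CauchyI)
      fix e :: real assume e: "0 < e"
      then obtain K where K: "\<And>m n. K \<le> m \<Longrightarrow> K \<le> n \<Longrightarrow> N (s m - s n) < c * e"
        using s c(1) unfolding M.MCauchy_def by (metis mult_pos_pos)
      have "dist (s m) (s n) < e" if "K \<le> m" "K \<le> n" for m n
        using K[OF that] c(3)[of "s m - s n"] c(1) by (simp add: dist_norm) (meson le_less_trans mult_less_cancel_left_pos)
      then show "\<exists>K. \<forall>m\<ge>K. \<forall>n\<ge>K. dist (s m) (s n) < e" by blast
    qed
    then obtain x where x: "s \<longlonglongrightarrow> x" using Cauchy_convergent_iff convergent_def by blast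
    have "(\<lambda>n. C * norm (s n - x)) \<longlonglongrightarrow> C * 0"
      using x by (intro tendsto_intros) (simp add: LIM_zero tendsto_norm_zero)
    then have "(\<lambda>n. C * norm (s n - x)) \<longlonglongrightarrow> 0" by simp
    then have "eventually (\<lambda>n. C * norm (s n - x) < e) sequentially" if "0 < e" for e
      using that by (rule order_tendstoD(2))
    then have "eventually (\<lambda>n. N (s n - x) < e) sequentially" if "0 < e" for e
      using that c(4) by (fastforce elim: eventually_mono intro: le_less_trans)
    then show "\<exists>x. limitin M.mtopology s x sequentially"
      by (auto simp: M.limitin_metric)
  qed
  then show ?thesis using N by (simp add: banach_norm_def)
qed

text \<open>The norm is \<open>max (sup\<^sub>n \<bar>g n x\<bar>) (dist x Y)\<close>. It dominates a multiple of the original norm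
because a vector close to some \<open>y \<in> Y\<close> has \<open>g n y\<close> close to \<open>g n x\<close>, and the functionals norm \<open>Y\<close>.
Adding \<open>\<plusminus> e n\<close> to \<open>x\<close> leaves the distance to \<open>Y\<close> and all functionals other than \<open>g n\<close>
unchanged. If \<open>g n x\<close> is small, the value of \<open>g n\<close> becomes almost \<open>\<plusminus> 1\<close>, so the norm of a unit
vector \<open>x\<close> stays close to one. The last hypothesis provides one such \<open>n\<close> for finitely many \<open>x\<close>
simultaneously.\<close>
lemma almost_square_renorming:
  fixes g :: "nat \<Rightarrow> 'a::real_normed_vector \<Rightarrow> real"
  assumes lin: "\<And>n. linear (g n)" and bound: "\<And>n x. \<bar>g n x\<bar> \<le> C * norm x"
    and CD: "0 < C" "0 < D"
    and Y: "subspace Y"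
    and norming: "\<And>y s. y \<in> Y \<Longrightarrow> (\<And>n. \<bar>g n y\<bar> \<le> s) \<Longrightarrow> norm y \<le> D * s"
    and e: "\<And>n. e n \<in> Y" and ge: "\<And>n k. g k (e n) = (if k = n then 1 else 0)"
    and small: "\<And>F \<epsilon>. finite F \<Longrightarrow> 0 < \<epsilon> \<Longrightarrow> \<exists>n. \<forall>x\<in>F. \<bar>g n x\<bar> < \<epsilon>"
  obtains N :: "'a \<Rightarrow> real" where "equivalent_norm N" "almost_square N"
proof -
  define s where "s x = (SUP n. \<bar>g n x\<bar>)" for x
  have bdd: "bdd_above (range (\<lambda>n. \<bar>g n x\<bar>))" for x
    using bound[of _ x] by (intro bdd_aboveI2)
  have gs: "\<bar>g n x\<bar> \<le> s x" for n x unfolding s_def by (rule cSUP_upper[OF _ bdd]) simp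
  have sI: "s x \<le> t" if "\<And>n. \<bar>g n x\<bar> \<le> t" for x t
    unfolding s_def using that by (intro cSUP_least) auto
  have s_nonneg: "0 \<le> s x" for x using gs[of 0 x] by linarith
  have s_add: "s (x + y) \<le> s x + s y" for x y
  proof (rule sI)
    show "\<bar>g n (x + y)\<bar> \<le> s x + s y" for n
      using gs[of n x] gs[of n y] linear_add[OF lin, of n x y] by linarith
  qed
  have s_scale: "s (r *\<^sub>R x) = \<bar>r\<bar> * s x" for r x
    by (rule homogeneous_if_subhomogeneous[of s])
      (use gs s_nonneg in \<open>auto intro!: sI mult_left_mono simp: linear_scale[OF lin] abs_mult\<close>)
  define N where "N x = max (s x) (infdist x Y)" for x
  have Y0: "Y \<noteq> {}" using subspace_0[OF Y] by blast
  have N_pos: "0 \<le> N x" for x using s_nonneg[of x] by (simp add: N_def)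
  have upper: "N x \<le> (1 + C) * norm x" for x
  proof -
    have "infdist x Y \<le> norm x" using infdist_le[OF subspace_0[OF Y], of x] by simp
    moreover have "s x \<le> C * norm x" using bound by (rule sI)
    moreover have "0 \<le> C * norm x" using CD by simp
    ultimately show ?thesis unfolding N_def distrib_right by (simp add: add_increasing)
  qed
  define B where "B = 1 + D * (1 + C)"
  have B: "0 < B" using CD by (simp add: B_def add_pos_pos)
  have lower: "norm x \<le> B * N x" for x
  proof (rule field_le_epsilon)
    fix \<epsilon> :: real assume \<epsilon>: "0 < \<epsilon>"
    define t where "t = N x + \<epsilon> / B"
    have t: "N x < t" "B * t = B * N x + \<epsilon>" using \<epsilon> B by (auto simp: t_def field_simps)
    then have "infdist x Y < t" by (simp add: N_def)
    then obtain y where y: "y \<in> Y" "norm (x - y) < t" using infdist_approx[OF Y0] by (metis dist_norm)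
    have "\<bar>g n y\<bar> \<le> (1 + C) * t" for n
    proof -
      have "g n y = g n x - g n (x - y)" using linear_diff[OF lin] by simp
      moreover have "\<bar>g n x\<bar> \<le> t" using gs[of n x] t(1) by (simp add: N_def)
      moreover have "\<bar>g n (x - y)\<bar> \<le> C * t"
        using y(2) CD by (intro order_trans[OF bound] mult_left_mono) auto
      ultimately show ?thesis unfolding distrib_right by linarith
    qed
    then have "norm y \<le> D * ((1 + C) * t)" by (rule norming[OF y(1)])
    moreover have "norm x \<le> norm (x - y) + norm y" using norm_triangle_ineq[of "x - y" y] by simp
    ultimately have "norm x \<le> B * t" using y(2) by (simp add: B_def algebra_simps)
    then show "norm x \<le> B * N x + \<epsilon>" using t by simp
  qed
  have N_add: "N (x + y) \<le> N x + N y" for x y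
    using s_add[of x y] infdist_subspace_add_le[OF Y, of x y] unfolding N_def by linarith
  have N_scale: "N (r *\<^sub>R x) = \<bar>r\<bar> * N x" for r x
    by (simp add: N_def s_scale infdist_subspace_scale[OF Y] max_mult_distrib_left)
  have N_zero: "N x = 0 \<longleftrightarrow> x = 0" for x
    using lower[of x] upper[of 0] N_pos[of 0] by auto
  have "is_norm N" unfolding is_norm_def using N_pos N_zero N_add N_scale by blast
  moreover have "inverse B * norm x \<le> N x" for x using lower[of x] B by (simp add: field_simps)
  ultimately have equiv: "equivalent_norm N"
    unfolding equivalent_norm_def using upper B CD(1)
    by (intro conjI exI[of _ "inverse B"] exI[of _ "1 + C"]) auto
  have N_e: "N (e n) = 1" for n
  proof -
    have "s (e n) = 1" using gs[of n "e n"] ge by (intro antisym sI) auto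
    then show ?thesis using e by (simp add: N_def)
  qed
  have near: "\<bar>N (x + t *\<^sub>R e n) - 1\<bar> \<le> \<epsilon>" if x: "N x = 1" and t: "\<bar>t\<bar> = 1" and \<epsilon>: "\<bar>g n x\<bar> < \<epsilon>" for x t n \<epsilon>
  proof -
    have gk: "g k (x + t *\<^sub>R e n) = g k x + (if k = n then t else 0)" for k
      by (simp add: linear_add[OF lin] linear_scale[OF lin] ge)
    have sx: "s x \<le> 1" and dx: "infdist x Y \<le> 1" using x by (auto simp: N_def)
    have "infdist (x + t *\<^sub>R e n) Y \<le> 1"
      using infdist_subspace_add_member[OF Y subspace_scale[OF Y e], of x t n] dx by simp
    moreover have "s (x + t *\<^sub>R e n) \<le> 1 + \<epsilon>"
    proof (rule sI)
      fix k
      show "\<bar>g k (x + t *\<^sub>R e n)\<bar> \<le> 1 + \<epsilon>"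
        using gk[of k] gs[of k x] sx \<epsilon> t by (cases "k = n") auto
    qed
    ultimately have "N (x + t *\<^sub>R e n) \<le> 1 + \<epsilon>" using \<epsilon> by (simp add: N_def)
    moreover have "1 - \<epsilon> \<le> s (x + t *\<^sub>R e n)"
      using gs[of n "x + t *\<^sub>R e n"] gk[of n] \<epsilon> t by auto
    ultimately show ?thesis unfolding N_def by linarith
  qed
  have "almost_square N"
    unfolding almost_square_def
  proof (intro allI impI)
    fix F assume F: "finite F \<and> F \<subseteq> unit_sphere N"
    have "\<forall>m. \<exists>n. \<forall>x\<in>F. \<bar>g n x\<bar> < inverse (real (Suc m))"
      using F by (intro allI small) auto
    then obtain n where n: "\<And>m x. x \<in> F \<Longrightarrow> \<bar>g (n m) x\<bar> < inverse (real (Suc m))" by metis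
    have lim: "(\<lambda>m. N (x + t *\<^sub>R e (n m))) \<longlonglongrightarrow> 1" if "x \<in> F" "\<bar>t\<bar> = 1" for x t
    proof -
      have "N x = 1" using F that by (auto simp: unit_sphere_def)
      then have "norm (N (x + t *\<^sub>R e (n m)) - 1) \<le> inverse (real (Suc m))" for m
        using near[OF _ that(2) n[OF that(1)]] by simp
      then have "(\<lambda>m. N (x + t *\<^sub>R e (n m)) - 1) \<longlonglongrightarrow> 0"
        by (intro Lim_null_comparison[OF _ LIMSEQ_inverse_real_of_nat]) simp
      then show ?thesis by (simp add: LIM_zero_iff)
    qed
    show "\<exists>y. range y \<subseteq> unit_sphere N \<and> (\<lambda>m. N (y m)) \<longlonglongrightarrow> 1 \<and>
        (\<forall>x\<in>F. (\<lambda>m. N (x + y m)) \<longlonglongrightarrow> 1 \<and> (\<lambda>m. N (x - y m)) \<longlonglongrightarrow> 1)"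
      using lim[of _ 1] lim[of _ "-1"] N_e
      by (intro exI[of _ "\<lambda>m. e (n m)"]) (auto simp: unit_sphere_def)
  qed
  with equiv show thesis by (rule that)
qed

section \<open>A sequence equivalent to the unit vectors of c0 in an almost square space\<close>

lemma is_norm_simps:
  assumes "is_norm N"
  shows "0 \<le> N x" "N x = 0 \<longleftrightarrow> x = 0" "N (x + y) \<le> N x + N y" "N (r *\<^sub>R x) = \<bar>r\<bar> * N x"
  using assms by (auto simp: is_norm_def)

text \<open>The vector \<open>a u + b y\<close> is \<open>(a + b)/2\<close> times \<open>u + y\<close> plus \<open>(a - b)/2\<close> times \<open>u - y\<close>, and
\<open>\<bar>a + b\<bar>/2 + \<bar>a - b\<bar>/2\<close> is the maximum of \<open>\<bar>a\<bar>\<close> and \<open>\<bar>b\<bar>\<close>. Thus the two signs in the definition of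
almost squareness control the whole square spanned by \<open>u\<close> and \<open>y\<close>.\<close>
lemma norm_combination_le:
  fixes N :: "'a::real_vector \<Rightarrow> real"
  assumes N: "is_norm N" and k: "N (u + y) \<le> k" "N (u - y) \<le> k"
    and m: "\<bar>a\<bar> \<le> m" "\<bar>b\<bar> \<le> m"
  shows "N (a *\<^sub>R u + b *\<^sub>R y) \<le> k * m"
proof -
  have half: "c *\<^sub>R z = (c / 2) *\<^sub>R z + (c / 2) *\<^sub>R z" for c and z :: 'a
    by (simp flip: scaleR_add_left)
  have "a *\<^sub>R u + b *\<^sub>R y = ((a + b) / 2) *\<^sub>R (u + y) + ((a - b) / 2) *\<^sub>R (u - y)"
    unfolding half[of a u] half[of b y]
    by (simp add: add_divide_distrib diff_divide_distrib scaleR_add_left scaleR_diff_left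
        scaleR_add_right scaleR_diff_right)
  then have "N (a *\<^sub>R u + b *\<^sub>R y) \<le> \<bar>(a + b) / 2\<bar> * N (u + y) + \<bar>(a - b) / 2\<bar> * N (u - y)"
    using is_norm_simps(3)[OF N] by (simp only: flip: is_norm_simps(4)[OF N])
  also have "\<dots> \<le> \<bar>(a + b) / 2\<bar> * k + \<bar>(a - b) / 2\<bar> * k"
    using k by (intro add_mono mult_left_mono) auto
  also have "\<dots> = (\<bar>(a + b) / 2\<bar> + \<bar>(a - b) / 2\<bar>) * k" by (simp add: distrib_right)
  also have "\<dots> \<le> m * k"
  proof (rule mult_right_mono)
    show "\<bar>(a + b) / 2\<bar> + \<bar>(a - b) / 2\<bar> \<le> m"
      using m by (simp add: abs_le_iff) (auto simp: abs_if field_simps)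
    show "0 \<le> k" using is_norm_simps(1)[OF N, of "u + y"] k by simp
  qed
  finally show ?thesis by (simp add: mult.commute)
qed

text \<open>Almost squareness speaks about unit vectors only, so it is applied to the normalized nonzero members
of \<open>F\<close>; the bound on combinations then undoes the normalization.\<close>
lemma almost_square_extension_step:
  assumes N: "is_norm N" and asq: "almost_square N" and F: "finite F" "\<And>s. s \<in> F \<Longrightarrow> N s \<le> r"
    and r: "1 \<le> r" "r < r'"
  obtains y where "N y = 1" "\<And>s. s \<in> F \<Longrightarrow> N (s + y) \<le> r' \<and> N (s - y) \<le> r'"
proof -
  define G where "G = (\<lambda>s. inverse (N s) *\<^sub>R s) ` (F - {0})"
  have "finite G" using F by (simp add: G_def)
  moreover have "G \<subseteq> unit_sphere N"
    using is_norm_simps(1,2)[OF N]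
    by (auto simp: G_def unit_sphere_def is_norm_simps(4)[OF N])
  ultimately obtain y where y: "range y \<subseteq> unit_sphere N"
    and lim: "\<And>u. u \<in> G \<Longrightarrow> (\<lambda>m. N (u + y m)) \<longlonglongrightarrow> 1" "\<And>u. u \<in> G \<Longrightarrow> (\<lambda>m. N (u - y m)) \<longlonglongrightarrow> 1"
    using asq unfolding almost_square_def by meson
  define k where "k = r' / r"
  have k: "1 < k" "k * r = r'" using r by (auto simp: k_def)
  have "eventually (\<lambda>m. \<forall>u\<in>G. N (u + y m) < k \<and> N (u - y m) < k) sequentially"
    using order_tendstoD(2)[OF lim(1) k(1)] order_tendstoD(2)[OF lim(2) k(1)] \<open>finite G\<close>
    by (intro eventually_ball_finite) (auto intro: eventually_conj)
  then obtain m where m: "\<And>u. u \<in> G \<Longrightarrow> N (u + y m) \<le> k \<and> N (u - y m) \<le> k"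
    using eventually_happens[of _ sequentially] by (fastforce intro: less_imp_le)
  have y1: "N (y m) = 1" using y by (auto simp: unit_sphere_def)
  show thesis
  proof (rule that[OF y1])
    fix s assume s: "s \<in> F"
    show "N (s + y m) \<le> r' \<and> N (s - y m) \<le> r'"
    proof (cases "s = 0")
      case True
      then show ?thesis using y1 is_norm_simps(4)[OF N, of "-1" "y m"] r by simp
    next
      case False
      define u where "u = inverse (N s) *\<^sub>R s"
      have u: "u \<in> G" "s = N s *\<^sub>R u" using s False is_norm_simps(2)[OF N, of s] by (auto simp: G_def u_def)
      have "\<bar>N s\<bar> \<le> r" using F(2)[OF s] is_norm_simps(1)[OF N, of s] by simp
      then have "N (N s *\<^sub>R u + b *\<^sub>R y m) \<le> r'" if "\<bar>b\<bar> = 1" for b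
        using norm_combination_le[OF N, of u "y m" k "N s" r b] m[OF u(1)] r that k by simp
      from this[of 1] this[of "-1"] show ?thesis using u(2) by simp
    qed
  qed
qed

text \<open>The finite set \<open>S n\<close> consists of all sums \<open>\<plusminus> y 0 \<plusminus> \<dots> \<plusminus> y (n - 1)\<close>. The next \<open>y n\<close> is chosen so
that the bound on the norms of these sums grows only slightly, from \<open>r n\<close> to \<open>r (Suc n)\<close>. Since a
cube is the convex hull of its vertices, a bound for all choices of signs is a bound for all
coefficients in \<open>[- 1, 1]\<close>.\<close>
lemma almost_square_sequence:
  fixes N :: "'a::real_vector \<Rightarrow> real"
  assumes N: "is_norm N" and asq: "almost_square N"
  obtains y :: "nat \<Rightarrow> 'a" where "\<And>n. N (y n) = 1"
    "\<And>n a. (\<And>i. i < n \<Longrightarrow> \<bar>a i\<bar> \<le> 1) \<Longrightarrow> N (\<Sum>i<n. a i *\<^sub>R y i) \<le> 3/2"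
proof -
  \<comment> \<open>The strict increase leaves room for an error at every step, and a limit below \<open>2\<close> is
     what makes the lower estimate for the coefficients possible.\<close>
  define r :: "nat \<Rightarrow> real" where "r n = 3/2 - (1/2) ^ Suc n" for n
  have r: "1 \<le> r n" "r n < r (Suc n)" "r n \<le> 3/2" for n
    using power_le_one[of "1/2::real" n] by (auto simp: r_def)
  define P where "P n S \<longleftrightarrow> finite S \<and> (\<forall>s\<in>S. N s \<le> r n) \<and> (n = 0 \<longrightarrow> S = {0})" for n and S :: "'a set"
  define Q where "Q S S' \<longleftrightarrow> (\<exists>y. N y = 1 \<and> S' = (\<lambda>s. s + y) ` S \<union> (\<lambda>s. s - y) ` S)" for S S' :: "'a set"
  have "\<exists>S. \<forall>n. P n (S n) \<and> Q (S n) (S (Suc n))"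
  proof (rule dependent_nat_choice[where Q = "\<lambda>_. Q"])
    have "N 0 \<le> r 0" using is_norm_simps(2)[OF N, of 0] r(1)[of 0] by simp
    then show "\<exists>S. P 0 S" by (intro exI[of _ "{0}"]) (simp add: P_def)
    fix S n assume S: "P n S"
    obtain y where "N y = 1" "\<And>s. s \<in> S \<Longrightarrow> N (s + y) \<le> r (Suc n) \<and> N (s - y) \<le> r (Suc n)"
      using almost_square_extension_step[OF N asq, of S "r n" "r (Suc n)"] S r by (auto simp: P_def)
    then show "\<exists>S'. P (Suc n) S' \<and> Q S S'"
      using S by (intro exI[of _ "(\<lambda>s. s + y) ` S \<union> (\<lambda>s. s - y) ` S"]) (auto simp: P_def Q_def)
  qed
  then obtain S where S: "\<And>n. P n (S n)" "\<And>n. Q (S n) (S (Suc n))" by blast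
  then obtain y where y: "\<And>n. N (y n) = 1"
    "\<And>n. S (Suc n) = (\<lambda>s. s + y n) ` S n \<union> (\<lambda>s. s - y n) ` S n"
    unfolding Q_def by metis
  have S0: "S 0 = {0}" and bound: "\<And>n s. s \<in> S n \<Longrightarrow> N s \<le> 3/2"
    using S(1) r(3) unfolding P_def by (blast intro: order_trans)+
  \<comment> \<open>The offset \<open>v\<close> absorbs the coordinates already moved from \<open>\<plusminus> 1\<close> to \<open>a i\<close>.\<close>
  have cube: "N (v + (\<Sum>i<n. a i *\<^sub>R y i)) \<le> K"
    if "\<And>i. i < n \<Longrightarrow> \<bar>a i\<bar> \<le> 1" "\<And>s. s \<in> S n \<Longrightarrow> N (v + s) \<le> K" for v n a K
    using that
  proof (induction n arbitrary: v)
    case 0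
    then show ?case using S0 by simp
  next
    case (Suc n)
    have "N ((v + a n *\<^sub>R y n) + s) \<le> K" if s: "s \<in> S n" for s
    proof -
      have "N (v + s + y n) \<le> K" "N (v + s - y n) \<le> K"
        using Suc.prems(2)[of "s + y n"] Suc.prems(2)[of "s - y n"] s y(2)[of n] by (auto simp: algebra_simps)
      then have "N (1 *\<^sub>R (v + s) + a n *\<^sub>R y n) \<le> K * 1"
        using Suc.prems(1)[of n] by (intro norm_combination_le[OF N]) auto
      then show ?thesis by (simp add: algebra_simps)
    qed
    then have "N ((v + a n *\<^sub>R y n) + (\<Sum>i<n. a i *\<^sub>R y i)) \<le> K"
      using Suc.prems(1) by (intro Suc.IH) auto
    then show ?case by (simp add: algebra_simps)
  qed
  show thesis
  proof (rule that[OF y(1)])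
    fix n and a :: "nat \<Rightarrow> real" assume "\<And>i. i < n \<Longrightarrow> \<bar>a i\<bar> \<le> 1"
    then show "N (\<Sum>i<n. a i *\<^sub>R y i) \<le> 3/2" using cube[of n a 0 "3/2"] bound by simp
  qed
qed

text \<open>The lower estimate is a consequence of the upper one, because the constant \<open>3/2\<close> is less than \<open>2\<close>.
If \<open>a j\<close> is the largest coefficient, then \<open>2 a j y j\<close> is the sum of \<open>\<Sum> a i y i\<close> and of the vector with
all coefficients except the \<open>j\<close>-th negated. The latter has norm at most \<open>3/2 \<bar>a j\<bar>\<close>, which leaves at
least \<open>\<bar>a j\<bar>/2\<close> for the former.\<close>
lemma almost_square_c0_basis:
  fixes N :: "'a::real_vector \<Rightarrow> real"
  assumes N: "is_norm N" and asq: "almost_square N"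
  obtains y :: "nat \<Rightarrow> 'a" where
    "\<And>n a M. 0 < M \<Longrightarrow> (\<And>i. i < n \<Longrightarrow> \<bar>a i\<bar> \<le> M) \<Longrightarrow> N (\<Sum>i<n. a i *\<^sub>R y i) \<le> 3/2 * M"
    "\<And>n a i. i < n \<Longrightarrow> \<bar>a i\<bar> \<le> 2 * N (\<Sum>i<n. a i *\<^sub>R y i)"
proof -
  obtain y :: "nat \<Rightarrow> 'a" where y: "\<And>n. N (y n) = 1"
    "\<And>n a. (\<And>i. i < n \<Longrightarrow> \<bar>a i\<bar> \<le> 1) \<Longrightarrow> N (\<Sum>i<n. a i *\<^sub>R y i) \<le> 3/2"
    using almost_square_sequence[OF N asq] by blast
  have upper: "N (\<Sum>i<n. a i *\<^sub>R y i) \<le> 3/2 * M"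
    if M: "0 < M" and a: "\<And>i. i < n \<Longrightarrow> \<bar>a i\<bar> \<le> M" for n a M
  proof -
    have "(\<Sum>i<n. a i *\<^sub>R y i) = M *\<^sub>R (\<Sum>i<n. (a i / M) *\<^sub>R y i)"
      using M by (simp add: scaleR_sum_right)
    moreover have "N (\<Sum>i<n. (a i / M) *\<^sub>R y i) \<le> 3/2"
      using a M by (intro y(2)) (simp add: divide_le_eq)
    ultimately show ?thesis using M by (simp add: is_norm_simps(4)[OF N])
  qed
  have lower: "\<bar>a i\<bar> \<le> 2 * N (\<Sum>i<n. a i *\<^sub>R y i)" if i: "i < n" for n a i
  proof -
    have "\<exists>j<n. \<forall>k<n. \<bar>a k\<bar> \<le> \<bar>a j\<bar>"
    proof -
      have "finite ((\<lambda>k. \<bar>a k\<bar>) ` {..<n})" "(\<lambda>k. \<bar>a k\<bar>) ` {..<n} \<noteq> {}" using i by auto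
      from Max_in[OF this] Max_ge[OF this(1)] show ?thesis by fastforce
    qed
    then obtain j where j: "j < n" "\<And>k. k < n \<Longrightarrow> \<bar>a k\<bar> \<le> \<bar>a j\<bar>" by blast
    show ?thesis
    proof (cases "a j = 0")
      case True
      then show ?thesis using j(2)[OF i] is_norm_simps(1)[OF N] by simp
    next
      case False
      define b where "b k = (if k = j then a k else - a k)" for k
      have "(\<Sum>k<n. a k *\<^sub>R y k) + (\<Sum>k<n. b k *\<^sub>R y k) = (\<Sum>k<n. if k = j then (2 * a j) *\<^sub>R y j else 0)"
        unfolding sum.distrib[symmetric] by (intro sum.cong) (auto simp: b_def simp flip: scaleR_add_left)
      also have "\<dots> = (2 * a j) *\<^sub>R y j" using j(1) by simp
      finally have "2 * \<bar>a j\<bar> = N ((\<Sum>k<n. a k *\<^sub>R y k) + (\<Sum>k<n. b k *\<^sub>R y k))"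
        using y(1)[of j] by (simp add: is_norm_simps(4)[OF N] abs_mult)
      also have "\<dots> \<le> N (\<Sum>k<n. a k *\<^sub>R y k) + N (\<Sum>k<n. b k *\<^sub>R y k)" by (rule is_norm_simps(3)[OF N])
      also have "N (\<Sum>k<n. b k *\<^sub>R y k) \<le> 3/2 * \<bar>a j\<bar>"
        using j False by (intro upper) (auto simp: b_def)
      finally show ?thesis using j(2)[OF i] by simp
    qed
  qed
  show thesis using that upper lower by blast
qed

section \<open>Embedding c0\<close>

lemma subspace_c0: "subspace c0"
  unfolding subspace_def c0_def
  by (auto simp: zero_bcontfun.rep_eq plus_bcontfun.rep_eq scaleR_bcontfun.rep_eq
      intro: tendsto_add_zero tendsto_mult_right_zero)

lemma closed_c0: "closed c0"
  unfolding closed_sequential_limits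
proof (intro allI impI, elim conjE)
  fix F f assume F: "\<forall>n. F n \<in> c0" and lim: "F \<longlonglongrightarrow> f"
  show "f \<in> c0" unfolding c0_def
  proof (simp, rule LIMSEQ_I)
    fix e :: real assume e: "0 < e"
    obtain n where n: "dist (F n) f < e / 2"
      using metric_LIMSEQ_D[OF lim, of "e / 2"] e by auto
    have "apply_bcontfun (F n) \<longlonglongrightarrow> 0" using F by (simp add: c0_def)
    then obtain K where K: "\<And>k. K \<le> k \<Longrightarrow> \<bar>apply_bcontfun (F n) k\<bar> < e / 2"
      using LIMSEQ_D[of "apply_bcontfun (F n)" 0 "e / 2"] e by auto
    have "norm (apply_bcontfun f k - 0) < e" if "K \<le> k" for k
    proof -
      have "dist (apply_bcontfun (F n) k) (apply_bcontfun f k) \<le> dist (F n) f" by (rule dist_bounded)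
      then show ?thesis using n K[OF that] by (simp add: dist_real_def)
    qed
    then show "\<exists>K. \<forall>k\<ge>K. norm (apply_bcontfun f k - 0) < e" by blast
  qed
qed

text \<open>A Cauchy sequence converges uniformly, and uniform limits preserve boundedness and continuity. The
domain is any topological space, which covers the index set \<open>nat\<close> of the sequences in \<open>c0\<close>.\<close>
lemma complete_UNIV_bcontfun:
  "complete (UNIV :: ('a::topological_space \<Rightarrow>\<^sub>C 'b::complete_space) set)"
proof (rule completeI)
  fix F :: "nat \<Rightarrow> 'a \<Rightarrow>\<^sub>C 'b" assume F: "Cauchy F"
  have "\<exists>g. \<forall>e>0. \<exists>M. \<forall>n x. M \<le> n \<and> True \<longrightarrow> dist (apply_bcontfun (F n) x) (g x) < e"
    unfolding uniformly_convergent_eq_cauchy[of "\<lambda>_. True" "\<lambda>n. apply_bcontfun (F n)"]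
    using F unfolding Cauchy_def by (metis dist_fun_lt_imp_dist_val_lt)
  then obtain g where "\<forall>e>0. \<exists>M. \<forall>n x. M \<le> n \<and> True \<longrightarrow> dist (apply_bcontfun (F n) x) (g x) < e" ..
  then have "uniform_limit UNIV (\<lambda>n. apply_bcontfun (F n)) g sequentially"
    unfolding uniform_limit_sequentially_iff by simp
  then obtain l where "F \<longlonglongrightarrow> l"
    by (rule uniform_limit_bcontfunE[OF _ sequentially_bot])
  then show "\<exists>l\<in>UNIV. F \<longlonglongrightarrow> l" by blast
qed

text \<open>The map is linear on \<open>V\<close> only, since the maps that embed \<open>c0\<close> need not be linear on all
bounded sequences.\<close>
lemma bounded_below_linear_image:
  fixes T :: "'b::real_normed_vector \<Rightarrow> 'a::real_normed_vector"
  assumes V: "subspace V" "complete V"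
    and add: "\<And>f g. f \<in> V \<Longrightarrow> g \<in> V \<Longrightarrow> T (f + g) = T f + T g"
    and scale: "\<And>r f. f \<in> V \<Longrightarrow> T (r *\<^sub>R f) = r *\<^sub>R T f"
    and upper: "\<And>f. f \<in> V \<Longrightarrow> norm (T f) \<le> C * norm f"
    and lower: "\<And>f. f \<in> V \<Longrightarrow> norm f \<le> D * norm (T f)"
  shows "subspace (T ` V)" "closed (T ` V)" "homeomorphism V (T ` V) T (inv_into V T)"
proof -
  have diff: "T (f - g) = T f - T g" if "f \<in> V" "g \<in> V" for f g
    using add[OF that(1) subspace_neg[OF V(1) that(2)]] scale[OF that(2), of "-1"] by simp
  have up: "dist (T f) (T g) \<le> C * dist f g" and low: "dist f g \<le> D * dist (T f) (T g)"
    if "f \<in> V" "g \<in> V" for f g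
    using upper[of "f - g"] lower[of "f - g"] that subspace_diff[OF V(1)] diff by (auto simp: dist_norm)
  have inj: "inj_on T V"
    by (rule inj_onI) (use low in fastforce)
  have "dist (T f) (T g) \<le> \<bar>C\<bar> * dist f g" if "f \<in> V" "g \<in> V" for f g
    using up[OF that] mult_right_mono[OF abs_ge_self[of C], of "dist f g"] by simp
  then have "\<bar>C\<bar>-lipschitz_on V T" by (intro lipschitz_onI) auto
  then have cont: "continuous_on V T" by (rule lipschitz_on_continuous_on)
  have "dist (inv_into V T x) (inv_into V T y) \<le> \<bar>D\<bar> * dist x y" if "x \<in> T ` V" "y \<in> T ` V" for x y
  proof -
    have "dist (inv_into V T x) (inv_into V T y) \<le> D * dist x y"
      using low[OF inv_into_into[OF that(1)] inv_into_into[OF that(2)]] that by (simp add: f_inv_into_f)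
    then show ?thesis using mult_right_mono[OF abs_ge_self[of D], of "dist x y"] by simp
  qed
  then have lip: "\<bar>D\<bar>-lipschitz_on (T ` V) (inv_into V T)" by (intro lipschitz_onI) auto
  then have "continuous_on (T ` V) (inv_into V T)" by (rule lipschitz_on_continuous_on)
  then show "homeomorphism V (T ` V) T (inv_into V T)"
    using inj cont by (auto simp: homeomorphism_def inv_into_into)
  show "subspace (T ` V)"
    unfolding subspace_def
  proof (intro conjI ballI allI)
    show "0 \<in> T ` V"
      using scale[OF subspace_0[OF V(1)], of 0] subspace_0[OF V(1)] by (simp add: image_iff) force
  next
    fix x y assume "x \<in> T ` V" "y \<in> T ` V"
    then show "x + y \<in> T ` V"
      by (auto simp: subspace_add[OF V(1)] simp flip: add)
  next
    fix r x assume "x \<in> T ` V"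
    then show "r *\<^sub>R x \<in> T ` V"
      by (auto simp: subspace_scale[OF V(1)] simp flip: scale)
  qed
  have "complete (T ` V)"
    unfolding complete_def
  proof (intro allI impI, elim conjE)
    fix h assume h: "\<forall>n. h n \<in> T ` V" "Cauchy h"
    define k where "k n = inv_into V T (h n)" for n :: nat
    have k: "k n \<in> V" "T (k n) = h n" for n
      using h(1) by (auto simp: k_def inv_into_into f_inv_into_f)
    have "Cauchy k"
      unfolding k_def using lipschitz_on_uniformly_continuous[OF lip] h(2)
      by (rule uniformly_continuous_on_Cauchy) (use h(1) in blast)
    then obtain l where l: "l \<in> V" "k \<longlonglongrightarrow> l"
      using V(2) k(1) unfolding complete_def by blast
    have "(\<lambda>n. T (k n)) \<longlonglongrightarrow> T l"
      using continuous_on_tendsto_compose[OF cont l(2,1)] k(1) by simp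
    then show "\<exists>x\<in>T ` V. h \<longlonglongrightarrow> x" using l(1) k(2) by auto
  qed
  then show "closed (T ` V)" by (rule complete_imp_closed)
qed

text \<open>The embedding sends \<open>f\<close> to \<open>\<Sum>i. f i y i\<close>. The upper estimate, applied to a tail of \<open>f\<close>, makes the
partial sums Cauchy, which is where the coefficients have to tend to \<open>0\<close>.\<close>
lemma contains_copy_of_c0_if_c0_basis:
  fixes y :: "nat \<Rightarrow> 'a::banach"
  assumes C: "0 < C"
    and upper: "\<And>n a M. 0 < M \<Longrightarrow> (\<And>i. i < n \<Longrightarrow> \<bar>a i\<bar> \<le> M) \<Longrightarrow> norm (\<Sum>i<n. a i *\<^sub>R y i) \<le> C * M"
    and lower: "\<And>n a i. i < n \<Longrightarrow> \<bar>a i\<bar> \<le> D * norm (\<Sum>i<n. a i *\<^sub>R y i)"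
  shows "contains_copy_of_c0 TYPE('a)"
proof -
  define T where "T f = (\<Sum>i. apply_bcontfun f i *\<^sub>R y i)" for f
  have summ: "summable (\<lambda>i. apply_bcontfun f i *\<^sub>R y i)" if f: "f \<in> c0" for f
    unfolding summable_Cauchy
  proof (intro allI impI)
    fix e :: real assume e: "0 < e"
    define M where "M = e / (2 * C)"
    have M: "0 < M" "C * M < e" using e C by (auto simp: M_def)
    obtain K where K: "\<And>k. K \<le> k \<Longrightarrow> \<bar>apply_bcontfun f k\<bar> < M"
      using f LIMSEQ_D[of "apply_bcontfun f" 0 M] M(1) by (auto simp: c0_def)
    have "norm (\<Sum>i=m..<n. apply_bcontfun f i *\<^sub>R y i) < e" if m: "K \<le> m" for m n
    proof -
      define a where "a i = (if m \<le> i then apply_bcontfun f i else 0)" for i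
      have "(\<Sum>i=m..<n. apply_bcontfun f i *\<^sub>R y i) = (\<Sum>i<n. a i *\<^sub>R y i)"
        by (intro sum.mono_neutral_cong_left) (auto simp: a_def)
      moreover have "norm (\<Sum>i<n. a i *\<^sub>R y i) \<le> C * M"
        using K m M by (intro upper) (auto simp: a_def intro: less_imp_le order_trans)
      ultimately show ?thesis using M by simp
    qed
    then show "\<exists>K. \<forall>m\<ge>K. \<forall>n. norm (\<Sum>i=m..<n. apply_bcontfun f i *\<^sub>R y i) < e" by blast
  qed
  have lim: "(\<lambda>n. norm (\<Sum>i<n. apply_bcontfun f i *\<^sub>R y i)) \<longlonglongrightarrow> norm (T f)" if "f \<in> c0" for f
    unfolding T_def by (intro tendsto_norm summable_LIMSEQ summ that)
  have up: "norm (T f) \<le> C * norm f" if f: "f \<in> c0" for f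
  proof (cases "f = 0")
    case False
    then have "norm (\<Sum>i<n. apply_bcontfun f i *\<^sub>R y i) \<le> C * norm f" for n
      using norm_bounded[of f] by (intro upper) auto
    then show ?thesis by (intro LIMSEQ_le_const2[OF lim[OF f]]) auto
  qed (simp add: T_def)
  have low: "norm f \<le> D * norm (T f)" if f: "f \<in> c0" for f
  proof (rule norm_bound)
    fix i
    have "(\<lambda>n. D * norm (\<Sum>i<n. apply_bcontfun f i *\<^sub>R y i)) \<longlonglongrightarrow> D * norm (T f)"
      by (intro tendsto_mult_left lim f)
    then show "norm (apply_bcontfun f i) \<le> D * norm (T f)"
      by (rule LIMSEQ_le_const) (use lower in \<open>auto intro!: exI[of _ "Suc i"]\<close>)
  qed
  have add: "T (f + g) = T f + T g" if "f \<in> c0" "g \<in> c0" for f g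
    using suminf_add[OF summ[OF that(1)] summ[OF that(2)]]
    by (simp add: T_def scaleR_add_left)
  have scale: "T (r *\<^sub>R f) = r *\<^sub>R T f" if "f \<in> c0" for r f
    using suminf_scaleR_right[OF summ[OF that], of r] by (simp add: T_def)
  have "complete c0" using complete_closed_subset[OF closed_c0 subset_UNIV complete_UNIV_bcontfun] .
  note image = bounded_below_linear_image[of c0 T C D, OF subspace_c0 this add scale up low]
  show ?thesis
    unfolding contains_copy_of_c0_def linearly_homeomorphic_to_c0_def
    using image add scale by blast
qed

theorem contains_copy_of_c0_if_almost_square:
  fixes N :: "'a::banach \<Rightarrow> real"
  assumes "equivalent_norm N" and asq: "almost_square N"
  shows "contains_copy_of_c0 TYPE('a)"
proof -
  obtain c C where N: "is_norm N" and c: "0 < c" "0 < C" "\<And>x. c * norm x \<le> N x" "\<And>x. N x \<le> C * norm x"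
    using assms by (auto simp: equivalent_norm_def)
  obtain y :: "nat \<Rightarrow> 'a" where y:
    "\<And>n a M. 0 < M \<Longrightarrow> (\<And>i. i < n \<Longrightarrow> \<bar>a i\<bar> \<le> M) \<Longrightarrow> N (\<Sum>i<n. a i *\<^sub>R y i) \<le> 3/2 * M"
    "\<And>n a i. i < n \<Longrightarrow> \<bar>a i\<bar> \<le> 2 * N (\<Sum>i<n. a i *\<^sub>R y i)"
    using almost_square_c0_basis[OF N asq] by blast
  show ?thesis
  proof (rule contains_copy_of_c0_if_c0_basis)
    show "0 < 3/2 / c" using c by simp
    show "norm (\<Sum>i<n. a i *\<^sub>R y i) \<le> 3/2 / c * M"
      if "0 < M" "\<And>i. i < n \<Longrightarrow> \<bar>a i\<bar> \<le> M" for n a M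
      using order_trans[OF c(3) y(1)[OF that]] c(1) by (simp add: field_simps)
    show "\<bar>a i\<bar> \<le> (2 * C) * norm (\<Sum>i<n. a i *\<^sub>R y i)" if "i < n" for n a i
      using y(2)[OF that, of a] c(4)[of "\<Sum>i<n. a i *\<^sub>R y i"] by simp
  qed
qed

section \<open>From a copy of c0 to an almost square norm\<close>

lemma bounded_if_continuous_linear_on:
  fixes T :: "'b::real_normed_vector \<Rightarrow> 'a::real_normed_vector"
  assumes V: "subspace V"
    and scale: "\<And>r f. f \<in> V \<Longrightarrow> T (r *\<^sub>R f) = r *\<^sub>R T f"
    and cont: "continuous_on V T"
  obtains C where "0 < C" "\<And>f. f \<in> V \<Longrightarrow> norm (T f) \<le> C * norm f"
proof -
  have V0: "0 \<in> V" using subspace_0[OF V] .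
  have T0: "T 0 = 0" using scale[OF V0, of 0] by simp
  have "\<exists>d>0. \<forall>f\<in>V. dist f 0 < d \<longrightarrow> dist (T f) (T 0) < 1"
    using cont V0 unfolding continuous_on_iff by force
  then obtain d where d: "0 < d" "\<And>f. f \<in> V \<Longrightarrow> norm f < d \<Longrightarrow> norm (T f) < 1"
    using T0 by auto
  have "norm (T f) \<le> 2 / d * norm f" if f: "f \<in> V" for f
  proof (cases "f = 0")
    case False
    define r where "r = d / (2 * norm f)"
    have r: "0 < r" "norm (r *\<^sub>R f) < d" using d(1) False by (auto simp: r_def)
    have "r * norm (T f) < 1" using d(2)[OF subspace_scale[OF V f] r(2)] scale[OF f] r(1) by simp
    then have "norm (T f) < 1 / r" using r(1) by (simp add: field_simps)
    then show ?thesis by (simp add: r_def)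
  qed (simp add: T0)
  then show thesis using that[of "2 / d"] d(1) by simp
qed

lemma apply_bcontfun_Bcontfun_unit:
  "apply_bcontfun (Bcontfun (\<lambda>k::nat. if k = n then 1 else 0 :: real)) k = (if k = n then 1 else 0)"
proof -
  have "(\<lambda>k::nat. if k = n then 1 else 0 :: real) \<in> bcontfun"
    by (rule bcontfun_normI[of _ 1]) auto
  then show ?thesis by (simp add: Bcontfun_inverse)
qed

text \<open>Outside the copy \<open>Y\<close> of \<open>c0\<close>, the extended coordinate functionals \<open>f n\<close> need not become small:
on a space like \<open>\<ell>\<^sub>\<infinity>\<close> they do not. Subtracting a cluster point \<open>L\<close> of the sequence repairs this.
The differences \<open>f n - L\<close> are still the coordinates on \<open>Y\<close>, and for finitely many vectors there is
always some \<open>n\<close> at which all of them are small.\<close>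
theorem almost_square_renorming_if_contains_copy_of_c0:
  assumes "contains_copy_of_c0 TYPE('a::banach)"
  obtains N :: "'a::banach \<Rightarrow> real" where "equivalent_norm N" "almost_square N"
proof -
  obtain Y :: "'a set" and T S where Y: "subspace Y" and hom: "homeomorphism c0 Y T S"
    and add: "\<And>f g. f \<in> c0 \<Longrightarrow> g \<in> c0 \<Longrightarrow> T (f + g) = T f + T g"
    and scale: "\<And>r f. f \<in> c0 \<Longrightarrow> T (r *\<^sub>R f) = r *\<^sub>R T f"
    using assms unfolding contains_copy_of_c0_def linearly_homeomorphic_to_c0_def by blast
  have ST: "S (T f) = f" "T f \<in> Y" if "f \<in> c0" for f
    using hom that by (auto simp: homeomorphism_def)
  have TS: "T (S y) = y" "S y \<in> c0" if "y \<in> Y" for y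
    using hom that by (auto simp: homeomorphism_def)
  have S_add: "S (x + y) = S x + S y" if "x \<in> Y" "y \<in> Y" for x y
    using that by (metis ST(1) TS add subspace_add subspace_c0)
  have S_scale: "S (r *\<^sub>R x) = r *\<^sub>R S x" if "x \<in> Y" for r x
    using that by (metis ST(1) TS scale subspace_scale subspace_c0)
  obtain D where D: "0 < D" "\<And>f. f \<in> c0 \<Longrightarrow> norm (T f) \<le> D * norm f"
    using bounded_if_continuous_linear_on[OF subspace_c0 scale homeomorphism_cont1[OF hom]] by blast
  obtain C where C: "0 < C" "\<And>y. y \<in> Y \<Longrightarrow> norm (S y) \<le> C * norm y"
    using bounded_if_continuous_linear_on[OF Y S_scale homeomorphism_cont2[OF hom]] by blast
  \<comment> \<open>The coordinate functionals of the copy of \<open>c0\<close>, extended to the whole space with a common bound.\<close>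
  have "\<exists>l. linear l \<and> (\<forall>x. \<bar>l x\<bar> \<le> C * norm x) \<and> (\<forall>y\<in>Y. l y = apply_bcontfun (S y) n)" for n
  proof -
    obtain l where "linear l" "\<And>x. \<bar>l x\<bar> \<le> C * norm x" "\<And>y. y \<in> Y \<Longrightarrow> l y = apply_bcontfun (S y) n"
    proof (rule Hahn_Banach_norm_extension[OF Y])
      fix y assume "y \<in> Y"
      then show "\<bar>apply_bcontfun (S y) n\<bar> \<le> C * norm y"
        using norm_bounded[of "S y" n] C(2)[of y] by simp
    qed (use C in \<open>auto simp: S_add S_scale\<close>)
    then show ?thesis by blast
  qed
  then obtain f where f_lin: "\<And>n. linear (f n)" and f_bound: "\<And>n x. \<bar>f n x\<bar> \<le> C * norm x"
    and f_Y: "\<And>n y. y \<in> Y \<Longrightarrow> f n y = apply_bcontfun (S y) n"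
    by metis
  obtain L where L: "linear L" "\<And>x. \<bar>L x\<bar> \<le> C * norm x"
    and cluster: "\<And>F \<epsilon>. finite F \<Longrightarrow> 0 < \<epsilon> \<Longrightarrow> \<exists>\<^sub>F n in sequentially. \<forall>x\<in>F. \<bar>f n x - L x\<bar> < \<epsilon>"
    using weak_star_cluster_point[of f C, OF f_lin f_bound] by (elim exE conjE) (rule that, auto)
  \<comment> \<open>On the copy of \<open>c0\<close> the coordinates of a vector converge to \<open>0\<close>, so the cluster point vanishes
     there and subtracting it does not change the coordinates.\<close>
  have L_Y: "L y = 0" if y: "y \<in> Y" for y
  proof (rule ccontr)
    assume ne: "L y \<noteq> 0"
    have "(\<lambda>n. f n y) \<longlonglongrightarrow> 0"
      using TS(2)[OF y] f_Y[OF y] by (simp add: c0_def)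
    then have "eventually (\<lambda>n. \<bar>f n y\<bar> < \<bar>L y\<bar> / 2) sequentially"
      using ne by (intro order_tendstoD(2)[OF tendsto_rabs_zero]) auto
    from frequently_eventually_frequently[OF _ this]
    have "\<exists>\<^sub>F n in sequentially. \<bar>f n y - L y\<bar> < \<bar>L y\<bar> / 2 \<and> \<bar>f n y\<bar> < \<bar>L y\<bar> / 2"
      using cluster[of "{y}" "\<bar>L y\<bar> / 2"] ne by simp
    from frequently_ex[OF this] obtain n
      where "\<bar>f n y - L y\<bar> < \<bar>L y\<bar> / 2" "\<bar>f n y\<bar> < \<bar>L y\<bar> / 2" by blast
    then show False by linarith
  qed
  define g where "g n x = f n x - L x" for n x
  have g_Y: "g n y = apply_bcontfun (S y) n" if "y \<in> Y" for n y
    using that by (simp add: g_def f_Y L_Y)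
  define u :: "nat \<Rightarrow> nat \<Rightarrow>\<^sub>C real" where "u n = Bcontfun (\<lambda>k. if k = n then 1 else 0)" for n
  have u: "apply_bcontfun (u n) k = (if k = n then 1 else 0)" for n k
    unfolding u_def by (rule apply_bcontfun_Bcontfun_unit)
  have u_c0: "u n \<in> c0" for n
  proof -
    have "eventually (\<lambda>k. apply_bcontfun (u n) k = 0) sequentially"
      using eventually_gt_at_top[of n] by eventually_elim (simp add: u)
    then show ?thesis unfolding c0_def by (simp add: tendsto_eventually)
  qed
  show thesis
  proof (rule almost_square_renorming[of g "2 * C" D Y "\<lambda>n. T (u n)"])
    show "linear (g n)" for n
      unfolding g_def using linear_compose_sub[OF f_lin L(1)] .
    show "\<bar>g n x\<bar> \<le> 2 * C * norm x" for n x
      using f_bound[of n x] L(2)[of x] unfolding g_def by linarith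
    show "norm y \<le> D * s" if y: "y \<in> Y" and s: "\<And>n. \<bar>g n y\<bar> \<le> s" for y s
    proof -
      have "norm (S y) \<le> s" using s g_Y[OF y] by (intro norm_bound) simp
      then have "D * norm (S y) \<le> D * s" using D(1) by simp
      then show ?thesis using D(2)[OF TS(2)[OF y]] TS(1)[OF y] by simp
    qed
    show "g k (T (u n)) = (if k = n then 1 else 0)" for n k
      using g_Y[OF ST(2)[OF u_c0]] ST(1)[OF u_c0] u by simp
    show "\<exists>n. \<forall>x\<in>F. \<bar>g n x\<bar> < \<epsilon>" if "finite F" "0 < \<epsilon>" for F \<epsilon>
      using frequently_ex[OF cluster[OF that]] unfolding g_def .
  qed (use C D Y ST u_c0 that in auto)
qed

theorem corollary2p4:
  "(\<exists>N::'a::banach \<Rightarrow> real. equivalent_norm N \<and> banach_norm N \<and> almost_square N) \<longleftrightarrow>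
     contains_copy_of_c0 TYPE('a)"
  by (metis contains_copy_of_c0_if_almost_square almost_square_renorming_if_contains_copy_of_c0
      equivalent_norm_imp_banach_norm)

end
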